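(* Let $H$ be the target Hamiltonian and $H_{\mathrm{NN}}$ the trained Hamiltonian neural network, satisfying the assumptions (1)-(4) listed in the context. Let $\varepsilon_0$ be the threshold of the KAM theorem (recalled in the context), let $c_1,c_2,c_3$, $L_{\mathrm{train}}$, $R_n$ and $n$ be the quantities in the generalization bound of assumption (4), and let $$\delta=\exp\left(-n\left(\frac{\varepsilon_0-c_1L_{\mathrm{train}}-c_2R_n}{c_3}\right)^2\right).$$ Then, with a probability of at least $1-\delta$, a set of invariant tori exists for the trained model $H_{\mathrm{NN}}$.
   Context: Assumptions. (1) The phase space has dimension $2M$ with $M\ge 2$. (2) The target system $\frac{du}{dt}=S\frac{\partial H}{\partial u}$, with $S$ a skew-symmetric matrix, is a Hamiltonian system that is integrable in the sense of Liouville: it has $M$ conserved quantities $F_1,\dots,F_M$ whose gradients are linearly independent at each point and whose pairwise Poisson brackets vanish, $\{F_i,F_j\}=0$ for all $i,j$. Here $\{F,G\}=\omega(X_F,X_G)$, where $\omega(v,w)=v^\top S^{-1}w$ and the vector field $X_F$ is defined by $\omega(X_F,w)=\frac{\partial F}{\partial u}\cdot w$ for all $w$. There are constants $a_1,\dots,a_M$ such that $K=\bigcap_{i=1}^M F_i^{-1}(a_i)$ is connected and compact. By the Liouville-Arnold theorem there are a neighborhood $\mathcal N$ of $K$, a set $\mathcal U\subset\mathbb R^M$ and a coordinate transformation $\phi:(\theta,J)\in\mathbb T^M\times\mathcal U\mapsto\phi(\theta,J)\in\mathcal N$ such that the transformed system is the Hamilton equation $$\frac{d}{dt}\begin{pmatrix}\theta\\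 J\end{pmatrix}=\begin{pmatrix}O&I\\-I&O\end{pmatrix}\begin{pmatrix}\partial H/\partial\theta\\ \partial H/\partial J\end{pmatrix}$$ whose Hamiltonian depends only on $J$ (action-angle variables). The target system is considered in the transformed coordinates on $\mathbb T^M\times\mathcal U$, and $H$ denotes the Hamiltonian in these coordinates. The trained model is the Hamilton equation with $H$ replaced by the neural network $H_{\mathrm{NN}}$. (3) The Hamiltonian $H:\mathbb T^M\times\mathcal U\to\mathbb R$ of the target system is $C^\infty$ and non-degenerate, i.e. $\det\frac{\partial^2H}{\partial J^2}\ne0$. The activation functions of the Hamiltonian neural network are $C^\infty$. (4) The training is performed on $n$ training data $u_1,\dots,u_n$ with the $p$-norm loss $\left\|\frac{\partial H(u_j)}{\partial u}-\frac{\partial H_{\mathrm{NN}}(u_j)}{\partial u}\right\|_p^p$ with $p>2M$, and the following generalization bound is assumed to hold: with constants $c_1,c_2,c_3$, with probability at least $1-\delta$, $$\sup|H(u)-H_{\mathrm{NN}}(u)|<c_1L_{\mathrm{train}}+c_2R_n+c_3\sqrt{\frac{\ln\frac1\delta}{n}},$$ where $L_{\mathrm{train}}$ is the training loss and $R_n$ is a bound on the Rademacher complexity of the class of losses associated with the hypothesis class. (The Rademacher complexity of $V\subset\mathbb R^n$ is $\frac1n\mathbb E_{\sigma}\sup_{v\in V}\sum_{i=1}^n\sigma_iv_i$, with $\sigma$ uniform on $\{-1,1\}^n$.) KAM theorem and its threshold. Let $\theta$ and $J$ be the action-angle variables for a $C^\infty$ integrable Hamiltonian $H_0$ on a $2M$-dimensional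 phase space with $M\ge2$. If $H_0$ is non-degenerate, $\det\frac{\partial^2H_0}{\partial J^2}\ne0$, then for the perturbed system $H_0(J)+\varepsilon F(\theta,J,\varepsilon)$ with $F\in C^\infty$ there exists $\varepsilon_0$ such that if $\sup|\varepsilon F|<\varepsilon_0$, there exists a set of $M$-dimensional tori that are invariant under the perturbed flow. On each invariant torus the flow of the perturbed system is quasi-periodic, and the set of invariant tori is large in the sense that its measure becomes full as $\varepsilon\to0$. In the claim, $\varepsilon_0$ is this threshold for the unperturbed Hamiltonian $H_0=H$, with $H_{\mathrm{NN}}$ regarded as the perturbed Hamiltonian.
   Formalization: The claim is proved for outcomes with c1·L_train + c2·R_n ≤ ε0, since otherwise the square in δ hides a negative sign and the claim can fail; as δ depends on the data, it is read level by level: for each d, with probability at least 1−d, δ ≤ d implies the claim. *)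

theory Defs
  imports "HOL-Probability.Probability"
begin

section \<open>Differential calculus\<close>

primrec Ck_on :: "nat \<Rightarrow> ('a::euclidean_space \<Rightarrow> 'b::euclidean_space) \<Rightarrow> 'a set \<Rightarrow> bool" where
  "Ck_on 0 f X \<longleftrightarrow> continuous_on X f"
| "Ck_on (Suc k) f X \<longleftrightarrow>
     (\<forall>x\<in>X. f differentiable (at x)) \<and> (\<forall>v. Ck_on k (\<lambda>x. frechet_derivative f (at x) v) X)"

text \<open>Only used on open sets, so that the full derivative \<^term>\<open>at x\<close> is the right one.\<close>

definition smooth_on :: "'a::euclidean_space set \<Rightarrow> ('a \<Rightarrow> 'b::euclidean_space) \<Rightarrow> bool" where
  "smooth_on X f \<longleftrightarrow> (\<forall>k. Ck_on k f X)"

definition grad :: "('a::euclidean_space \<Rightarrow> real) \<Rightarrow> 'a \<Rightarrow> 'a" where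
  "grad f x = (THE D. GDERIV f x :> D)"


section \<open>Liouville integrability of the target system \<open>du/dt = S grad h\<close>\<close>

definition solution_on :: "'a::euclidean_space set \<Rightarrow> ('a \<Rightarrow> 'a) \<Rightarrow> (real \<Rightarrow> 'a) \<Rightarrow> real set \<Rightarrow> bool" where
  "solution_on X V c I \<longleftrightarrow>
     is_interval I \<and> (\<forall>t\<in>I. c t \<in> X \<and> (c has_vector_derivative V (c t)) (at t within I))"

definition sympl :: "real^'n^'n \<Rightarrow> real^'n \<Rightarrow> real^'n \<Rightarrow> real" where
  "sympl S v w = v \<bullet> (matrix_inv S *v w)"

definition sympl_field :: "real^'n^'n \<Rightarrow> (real^'n \<Rightarrow> real) \<Rightarrow> real^'n \<Rightarrow> real^'n" where
  "sympl_field S F u = (THE X. \<forall>w. sympl S X w = grad F u \<bullet> w)"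

definition poisson :: "real^'n^'n \<Rightarrow> (real^'n \<Rightarrow> real) \<Rightarrow> (real^'n \<Rightarrow> real) \<Rightarrow> real^'n \<Rightarrow> real" where
  "poisson S F G u = sympl S (sympl_field S F u) (sympl_field S G u)"

definition conserved :: "(real^'n) set \<Rightarrow> real^'n^'n \<Rightarrow> (real^'n \<Rightarrow> real) \<Rightarrow> (real^'n \<Rightarrow> real) \<Rightarrow> bool" where
  "conserved X S h F \<longleftrightarrow>
     (\<forall>c I. solution_on X (\<lambda>u. S *v grad h u) c I \<longrightarrow> (\<forall>s\<in>I. \<forall>t\<in>I. F (c s) = F (c t)))"

text \<open>The phase space is an open set \<open>X\<close> of \<open>\<real>\<^sup>2\<^sup>M\<close>, where \<open>M = CARD('m)\<close>; the conserved
  quantities are indexed by \<^typ>\<open>'m\<close>.\<close>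

definition liouville_integrable ::
  "(real^'n) set \<Rightarrow> real^'n^'n \<Rightarrow> (real^'n \<Rightarrow> real) \<Rightarrow> ('m::finite \<Rightarrow> real^'n \<Rightarrow> real) \<Rightarrow> bool" where
  "liouville_integrable X S h F \<longleftrightarrow>
     CARD('n) = 2 * CARD('m) \<and> open X \<and> transpose S = - S \<and> invertible S \<and>
     Ck_on 1 h X \<and> (\<forall>i. Ck_on 1 (F i) X) \<and>
     (\<forall>i. conserved X S h (F i)) \<and>
     (\<forall>u\<in>X. \<forall>r. (\<Sum>i\<in>UNIV. r i *\<^sub>R grad (F i) u) = 0 \<longrightarrow> (\<forall>i. r i = 0)) \<and>
     (\<forall>u\<in>X. \<forall>i j. poisson S (F i) (F j) u = 0)"


section \<open>Hamiltonian dynamics on \<open>T\<^sup>M \<times> U\<close>\<close>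

text \<open>A function or vector field on \<open>T\<^sup>M \<times> U\<close> is given by its lift to \<open>\<real>\<^sup>M \<times> U\<close>, \<open>2\<pi>\<close>-periodic in
  each angle. Subsets of \<open>T\<^sup>M \<times> U\<close> are honest subsets of \<open>(S\<^sup>1)\<^sup>M \<times> U\<close>, with \<open>S\<^sup>1\<close> the complex unit
  circle; \<open>proj\<close> is the covering map.\<close>

type_synonym 'm phase = "(real^'m) \<times> (real^'m)"
type_synonym 'm tphase = "(complex^'m) \<times> (real^'m)"

definition torus_pt :: "real^('m::finite) \<Rightarrow> complex^'m" where
  "torus_pt \<theta> = (\<chi> i. cis (\<theta> $ i))"

definition std_torus :: "(complex^('m::finite)) set" where
  "std_torus = {z. \<forall>i. cmod (z $ i) = 1}"

definition proj :: "('m::finite) phase \<Rightarrow> 'm tphase" where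
  "proj p = (torus_pt (fst p), snd p)"

definition periodic_on :: "(real^('m::finite)) set \<Rightarrow> ('m phase \<Rightarrow> 'b) \<Rightarrow> bool" where
  "periodic_on U f \<longleftrightarrow> (\<forall>p\<in>UNIV \<times> U. \<forall>q\<in>UNIV \<times> U. proj p = proj q \<longrightarrow> f p = f q)"

definition ham_field :: "(('m::finite) phase \<Rightarrow> real) \<Rightarrow> 'm phase \<Rightarrow> 'm phase" where
  "ham_field K p = (snd (grad K p), - fst (grad K p))"

definition J_only :: "(real^('m::finite)) set \<Rightarrow> ('m phase \<Rightarrow> real) \<Rightarrow> bool" where
  "J_only U H \<longleftrightarrow> (\<forall>J\<in>U. \<forall>\<theta> \<theta>'. H (\<theta>, J) = H (\<theta>', J))"

definition hess_J :: "(('m::finite) phase \<Rightarrow> real) \<Rightarrow> 'm phase \<Rightarrow> real^'m^'m" where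
  "hess_J H p =
     matrix (frechet_derivative (\<lambda>J. grad (\<lambda>J'. H (fst p, J')) J) (at (snd p)))"

definition nondegenerate :: "(real^('m::finite)) set \<Rightarrow> ('m phase \<Rightarrow> real) \<Rightarrow> bool" where
  "nondegenerate U H \<longleftrightarrow> (\<forall>p\<in>UNIV \<times> U. det (hess_J H p) \<noteq> 0)"

text \<open>The coordinate transformation \<open>\<phi>\<close> from \<open>T\<^sup>M \<times> U\<close> onto a neighbourhood \<open>N\<close> of the level set.
  The last conjunct says that \<open>\<phi>\<close> carries the Hamiltonian vector field of \<open>H\<close> to that of the target
  system, i.e. that in the coordinates \<open>(\<theta>, J)\<close> the latter is the Hamilton equation of \<open>H\<close>.\<close>

definition action_angle ::
  "(real^'n) set \<Rightarrow> real^'n^'n \<Rightarrow> (real^'n \<Rightarrow> real) \<Rightarrow> (real^'n) set \<Rightarrow>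
   (real^'n) set \<Rightarrow> (real^('m::finite)) set \<Rightarrow> ('m phase \<Rightarrow> real^'n) \<Rightarrow> ('m phase \<Rightarrow> real) \<Rightarrow> bool" where
  "action_angle X S h K N U \<phi> H \<longleftrightarrow>
     open N \<and> K \<subseteq> N \<and> N \<subseteq> X \<and> open U \<and>
     Ck_on 1 \<phi> (UNIV \<times> U) \<and> \<phi> ` (UNIV \<times> U) = N \<and>
     (\<forall>p\<in>UNIV \<times> U. \<forall>q\<in>UNIV \<times> U. \<phi> p = \<phi> q \<longleftrightarrow> proj p = proj q) \<and>
     (\<forall>p\<in>UNIV \<times> U. bij (frechet_derivative \<phi> (at p))) \<and>
     (\<forall>p\<in>UNIV \<times> U. H p = h (\<phi> p)) \<and> J_only U H \<and>
     (\<forall>p\<in>UNIV \<times> U. frechet_derivative \<phi> (at p) (ham_field H p) = S *v grad h (\<phi> p))"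


section \<open>Invariant tori and the KAM threshold\<close>

definition flow_invariant :: "(real^('m::finite)) set \<Rightarrow> ('m phase \<Rightarrow> real) \<Rightarrow> 'm tphase set \<Rightarrow> bool" where
  "flow_invariant U K T \<longleftrightarrow>
     (\<forall>c I. solution_on (UNIV \<times> U) (ham_field K) c I \<longrightarrow>
        (\<forall>s\<in>I. \<forall>t\<in>I. proj (c s) \<in> T \<longrightarrow> proj (c t) \<in> T))"

definition rationally_independent :: "real^('m::finite) \<Rightarrow> bool" where
  "rationally_independent \<nu> \<longleftrightarrow>
     (\<forall>k :: 'm \<Rightarrow> int. (\<Sum>i\<in>UNIV. of_int (k i) * \<nu> $ i) = 0 \<longrightarrow> (\<forall>i. k i = 0))"

definition quasi_periodic_torus :: "(real^('m::finite)) set \<Rightarrow> ('m phase \<Rightarrow> real) \<Rightarrow> 'm tphase set \<Rightarrow> bool" where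
  "quasi_periodic_torus U K T \<longleftrightarrow>
     (\<exists>(\<Phi> :: complex^'m \<Rightarrow> 'm tphase) \<Psi> (\<nu> :: real^'m). homeomorphism std_torus T \<Phi> \<Psi> \<and> rationally_independent \<nu> \<and>
        (\<forall>\<psi>. \<exists>c. solution_on (UNIV \<times> U) (ham_field K) c UNIV \<and>
             (\<forall>t. proj (c t) = \<Phi> (torus_pt (\<psi> + t *\<^sub>R \<nu>)))))"

definition invariant_tori :: "(real^('m::finite)) set \<Rightarrow> ('m phase \<Rightarrow> real) \<Rightarrow> 'm tphase set set \<Rightarrow> bool" where
  "invariant_tori U K \<T> \<longleftrightarrow>
     \<T> \<noteq> {} \<and>
     (\<forall>T\<in>\<T>. T \<subseteq> std_torus \<times> U \<and> flow_invariant U K T \<and> quasi_periodic_torus U K T)"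

definition sup_norm :: "(real^('m::finite)) set \<Rightarrow> ('m phase \<Rightarrow> real) \<Rightarrow> ereal" where
  "sup_norm U f = (SUP p\<in>UNIV \<times> U. ereal \<bar>f p\<bar>)"

text \<open>The set of tori \<open>\<T> e\<close> has full measure in the limit \<open>e \<rightarrow> 0\<close> (over admissible \<open>e\<close>), locally in
  the actions. The measurable cover \<open>B e\<close> of the complement avoids assuming that the union of the
  tori is measurable.\<close>

definition asymptotically_full :: "(real^('m::finite)) set \<Rightarrow> real set \<Rightarrow> (real \<Rightarrow> 'm tphase set set) \<Rightarrow> bool" where
  "asymptotically_full U E \<T> \<longleftrightarrow>
     (\<forall>C. compact C \<and> C \<subseteq> U \<longrightarrow>
       (\<exists>B. (\<forall>e. B e \<in> sets (lborel :: 'm phase measure) \<and>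
               {p. (\<forall>i. 0 \<le> fst p $ i \<and> fst p $ i \<le> 2 * pi) \<and> snd p \<in> C \<and> proj p \<notin> \<Union>(\<T> e)} \<subseteq> B e) \<and>
            ((\<lambda>e. emeasure lborel (B e)) \<longlongrightarrow> 0) (at 0 within E)))"

text \<open>\<open>\<epsilon>0\<close> is a threshold, in the sense of the KAM theorem, for the perturbed systems
  \<open>H0(J) + e F(\<theta>, J, e)\<close>.\<close>

definition kam_threshold ::
  "(real^('m::finite)) set \<Rightarrow> ('m phase \<Rightarrow> real) \<Rightarrow> ('m phase \<Rightarrow> real \<Rightarrow> real) \<Rightarrow> real \<Rightarrow> bool" where
  "kam_threshold U H0 F \<epsilon>0 \<longleftrightarrow>
     0 < \<epsilon>0 \<and>
     (CARD('m) \<ge> 2 \<and> open U \<and>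
      smooth_on (UNIV \<times> U) H0 \<and> J_only U H0 \<and> nondegenerate U H0 \<and>
      smooth_on ((UNIV \<times> U) \<times> UNIV) (\<lambda>(p, e). F p e) \<and> (\<forall>e. periodic_on U (\<lambda>p. F p e)) \<longrightarrow>
      (\<exists>\<T>. (\<forall>e. sup_norm U (\<lambda>p. e * F p e) < ereal \<epsilon>0 \<longrightarrow>
                invariant_tori U (\<lambda>p. H0 p + e * F p e) (\<T> e)) \<and>
           asymptotically_full U {e. sup_norm U (\<lambda>p. e * F p e) < ereal \<epsilon>0} \<T>))"


section \<open>Neural networks\<close>

datatype layer =
  Layer (width: nat) (weight: "nat \<Rightarrow> nat \<Rightarrow> real") (bias: "nat \<Rightarrow> real") (act: "real \<Rightarrow> real")

type_synonym network = "layer list"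

primrec net_eval :: "network \<Rightarrow> nat \<Rightarrow> (nat \<Rightarrow> real) \<Rightarrow> nat \<Rightarrow> real" where
  "net_eval [] d x = x"
| "net_eval (l # ls) d x =
     net_eval ls (width l) (\<lambda>i. act l ((\<Sum>j<d. weight l i j * x j) + bias l i))"

text \<open>The scalar output is component 0 of the last layer (a linear output layer has the identity as
  activation). The network is fed with \<open>d\<close> input coordinates \<open>enc 0 p, \<dots>, enc (d-1) p\<close> of the
  phase space point \<open>p\<close>.\<close>

definition H_net :: "nat \<Rightarrow> (nat \<Rightarrow> ('m::finite) phase \<Rightarrow> real) \<Rightarrow> network \<Rightarrow> 'm phase \<Rightarrow> real" where
  "H_net d enc G p = net_eval G d (\<lambda>j. enc j p) 0"


section \<open>Loss, Rademacher complexity, confidence statements\<close>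

definition pnorm :: "real \<Rightarrow> ('m::finite) phase \<Rightarrow> real" where
  "pnorm p v = ((\<Sum>i\<in>UNIV. \<bar>fst v $ i\<bar> powr p) + (\<Sum>i\<in>UNIV. \<bar>snd v $ i\<bar> powr p)) powr (1 / p)"

definition loss :: "real \<Rightarrow> (('m::finite) phase \<Rightarrow> real) \<Rightarrow> ('m phase \<Rightarrow> real) \<Rightarrow> 'm phase \<Rightarrow> real" where
  "loss p H K u = pnorm p (grad H u - grad K u) powr p"

definition train_loss ::
  "real \<Rightarrow> (('m::finite) phase \<Rightarrow> real) \<Rightarrow> ('m phase \<Rightarrow> real) \<Rightarrow> nat \<Rightarrow> (nat \<Rightarrow> 'm phase) \<Rightarrow> real" where
  "train_loss p H K n u = (\<Sum>j<n. loss p H K (u j)) / real n"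

text \<open>Vectors in \<open>\<real>\<^sup>n\<close> are functions on \<open>{..<n}\<close>; the value is \<open>\<infinity>\<close> if some supremum is infinite.\<close>

definition rademacher :: "nat \<Rightarrow> (nat \<Rightarrow> real) set \<Rightarrow> ereal" where
  "rademacher n V =
     ereal (1 / real n) * (ereal (1 / 2 ^ n) *
       (\<Sum>\<sigma>\<in>{..<n} \<rightarrow>\<^sub>E {-1, 1}. SUP v\<in>V. ereal (\<Sum>i<n. \<sigma> i * v i)))"

definition with_prob_ge :: "'w measure \<Rightarrow> real \<Rightarrow> ('w \<Rightarrow> bool) \<Rightarrow> bool" where
  "with_prob_ge P q Q \<longleftrightarrow> (\<exists>A\<in>sets P. measure P A \<ge> q \<and> (\<forall>w\<in>A. Q w))"

text \<open>``With probability at least \<open>1 - \<delta>\<close>, \<open>Q\<close>'', where \<open>\<delta>\<close> may depend on the outcome (as it does when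
  computed from the observed training loss): at every fixed level \<open>d\<close>, with probability at least
  \<open>1 - d\<close>, an outcome whose \<open>\<delta>\<close> is at most \<open>d\<close> satisfies \<open>Q\<close>. For constant \<open>\<delta>\<close> this is the usual
  statement, by the lemma below.\<close>

definition holds_with_confidence :: "'w measure \<Rightarrow> ('w \<Rightarrow> real) \<Rightarrow> ('w \<Rightarrow> bool) \<Rightarrow> bool" where
  "holds_with_confidence P \<delta> Q \<longleftrightarrow>
     (\<forall>d. 0 < d \<and> d < 1 \<longrightarrow> with_prob_ge P (1 - d) (\<lambda>w. \<delta> w \<le> d \<longrightarrow> Q w))"

lemma holds_with_confidence_const:
  assumes "prob_space P" and "0 < d"
  shows "holds_with_confidence P (\<lambda>_. d) Q \<longleftrightarrow> with_prob_ge P (1 - d) Q"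
proof -
  interpret prob_space P by fact
  have triv: "with_prob_ge P q Q" if "q \<le> 0" for q
    unfolding with_prob_ge_def using that by (intro bexI[of _ "{}"]) auto
  show ?thesis
  proof
    assume *: "holds_with_confidence P (\<lambda>_. d) Q"
    show "with_prob_ge P (1 - d) Q"
    proof (cases "d < 1")
      case True
      with * \<open>0 < d\<close> have "with_prob_ge P (1 - d) (\<lambda>w. d \<le> d \<longrightarrow> Q w)"
        unfolding holds_with_confidence_def by blast
      then show ?thesis by simp
    qed (simp add: triv)
  next
    assume *: "with_prob_ge P (1 - d) Q"
    show "holds_with_confidence P (\<lambda>_. d) Q"
      unfolding holds_with_confidence_def
    proof (intro allI impI)
      fix e :: real
      assume e: "0 < e \<and> e < 1"
      show "with_prob_ge P (1 - e) (\<lambda>w. d \<le> e \<longrightarrow> Q w)"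
      proof (cases "d \<le> e")
        case True
        then have le: "1 - e \<le> 1 - d" by simp
        from * obtain A where "A \<in> sets P" "measure P A \<ge> 1 - d" "\<forall>w\<in>A. Q w"
          unfolding with_prob_ge_def by blast
        with le show ?thesis
          unfolding with_prob_ge_def by (intro bexI[of _ A]) auto
      next
        case False
        with e show ?thesis
          unfolding with_prob_ge_def by (intro bexI[of _ "space P"]) (auto simp: prob_space)
      qed
    qed
  qed
qed

end

theory Submission
  imports Defs
begin

text \<open>The KAM threshold \<open>\<epsilon>0\<close> applies to the family \<open>H + e (H\<^sub>N\<^sub>N - H)\<close>, whose member at \<open>e = 1\<close> is the
  trained model. So the model has invariant tori as soon as \<open>sup \<bar>H - H\<^sub>N\<^sub>N\<bar> < \<epsilon>0\<close>, provided that the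
  perturbation \<open>H\<^sub>N\<^sub>N - H\<close> is smooth and periodic in the angles.

  Smoothness of \<open>H\<^sub>N\<^sub>N\<close> reduces to the closure of \<open>C\<^sup>k\<close> functions under sums, products and composition
  with the activation functions, and is propagated through the layers (\<open>smooth_on_net_eval\<close>).
  Periodicity of \<open>H\<close> holds because \<open>H = h \<circ> \<phi>\<close> and \<open>\<phi>\<close> identifies exactly the points that have the
  same image in \<open>T\<^sup>M \<times> U\<close>. Together these give a deterministic criterion
  (\<open>invariant_tori_of_small_error\<close>).

  The probability enters by inverting the formula for \<open>\<delta>\<close>. The generalization bound used at a fixed
  level \<open>d\<close> has the slack term \<open>c3 sqrt (ln (1/d) / n)\<close>, and for \<open>c3 > 0\<close> the inequality \<open>\<delta> \<le> d\<close>
  says precisely that this term is at most \<open>\<bar>\<epsilon>0 - c1 L - c2 R\<bar>\<close>. The bound is thus at most \<open>\<epsilon>0\<close> wherever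
  \<open>\<delta> \<le> d\<close> and \<open>c1 L + c2 R \<le> \<epsilon>0\<close> (\<open>confidence_slack_le\<close>).\<close>


section \<open>Calculus of \<open>C\<^sup>k\<close> functions\<close>

lemma Ck_on_SucD:
  assumes "Ck_on (Suc k) f X" "x \<in> X"
  shows "(f has_derivative frechet_derivative f (at x)) (at x)"
  using assms by (simp add: frechet_derivative_works)

lemma Ck_on_cong:
  assumes "open X" "\<And>x. x \<in> X \<Longrightarrow> f x = g x" "Ck_on k f X"
  shows "Ck_on k g X"
  using assms(2,3)
proof (induction k arbitrary: f g)
  case 0
  then show ?case by (simp cong: continuous_on_cong)
next
  case (Suc k)
  have D: "(g has_derivative frechet_derivative f (at x)) (at x)" if "x \<in> X" for x
    using has_derivative_transform_within_open[OF Ck_on_SucD[OF Suc.prems(2) that] \<open>open X\<close> that]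
      Suc.prems(1) by blast
  have "Ck_on k (\<lambda>x. frechet_derivative g (at x) v) X" for v
    by (rule Suc.IH[of "\<lambda>x. frechet_derivative f (at x) v"])
      (use Suc.prems(2) frechet_derivative_at[OF D] in simp_all)
  then show ?case
    using D by (auto simp: differentiable_def)
qed

text \<open>The class of \<open>C\<^sup>k\<close> functions is defined through the canonical derivative; this rule allows any
  explicit derivative computed by the differentiation rules instead.\<close>

lemma Ck_on_SucI:
  assumes "open X" "\<And>x. x \<in> X \<Longrightarrow> (f has_derivative f' x) (at x)"
    and "\<And>v. Ck_on k (\<lambda>x. f' x v) X"
  shows "Ck_on (Suc k) f X"
proof -
  have "Ck_on k (\<lambda>x. frechet_derivative f (at x) v) X" for v
    by (rule Ck_on_cong[OF \<open>open X\<close> _ assms(3)])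
      (use frechet_derivative_at[OF assms(2)] in simp)
  then show ?thesis
    using assms(2) by (auto simp: differentiable_def)
qed

lemma Ck_on_Suc_imp_Ck_on: "Ck_on (Suc k) f X \<Longrightarrow> Ck_on k f X"
proof (induction k arbitrary: f)
  case 0
  then show ?case
    by (auto intro!: continuous_at_imp_continuous_on differentiable_imp_continuous_within)
next
  case (Suc k)
  then show ?case by simp
qed

lemma Ck_on_const:
  assumes "open X"
  shows "Ck_on k (\<lambda>_. c) X"
proof (induction k arbitrary: c)
  case (Suc k)
  show ?case
    by (rule Ck_on_SucI[OF assms, where f' = "\<lambda>_ _. 0"]) (use Suc in auto)
qed simp

lemma Ck_on_add:
  assumes "open X" "Ck_on k f X" "Ck_on k g X"
  shows "Ck_on k (\<lambda>x. f x + g x) X"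
  using assms(2,3)
proof (induction k arbitrary: f g)
  case 0
  then show ?case by (auto intro: continuous_on_add)
next
  case (Suc k)
  show ?case
    by (rule Ck_on_SucI[OF \<open>open X\<close> has_derivative_add[OF Ck_on_SucD[OF Suc.prems(1)]
          Ck_on_SucD[OF Suc.prems(2)]]])
      (use Suc in auto)
qed

lemma Ck_on_mult:
  fixes f g :: "'a::euclidean_space \<Rightarrow> real"
  assumes "open X" "Ck_on k f X" "Ck_on k g X"
  shows "Ck_on k (\<lambda>x. f x * g x) X"
  using assms(2,3)
proof (induction k arbitrary: f g)
  case 0
  then show ?case by (auto intro: continuous_on_mult)
next
  case (Suc k)
  note lower = Suc.prems[THEN Ck_on_Suc_imp_Ck_on]
  show ?case
    by (rule Ck_on_SucI[OF \<open>open X\<close> has_derivative_mult[OF Ck_on_SucD[OF Suc.prems(1)]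
          Ck_on_SucD[OF Suc.prems(2)]]])
      (use Suc lower in \<open>auto intro!: Ck_on_add[OF \<open>open X\<close>]\<close>)
qed

text \<open>The chain rule turns the derivative of \<open>g \<circ> f\<close> in direction \<open>v\<close> into the product of \<open>g' \<circ> f\<close> and
  the derivative of \<open>f\<close> in direction \<open>v\<close>, so that the induction hypothesis is needed for \<open>g'\<close> and \<open>f\<close>,
  both of class \<open>C\<^sup>k\<close>.\<close>

lemma Ck_on_compose_real:
  fixes f :: "'a::euclidean_space \<Rightarrow> real" and g :: "real \<Rightarrow> real"
  assumes "open X" "Ck_on k g UNIV" "Ck_on k f X"
  shows "Ck_on k (\<lambda>x. g (f x)) X"
  using assms(2,3)
proof (induction k arbitrary: g)
  case 0
  then show ?case by (auto intro: continuous_on_compose2)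
next
  case (Suc k)
  define g' where "g' y = frechet_derivative g (at y) 1" for y
  have g': "(g has_derivative (\<lambda>t. t * g' y)) (at y)" for y
  proof -
    have D: "(g has_derivative frechet_derivative g (at y)) (at y)"
      using Ck_on_SucD[OF Suc.prems(1)] by simp
    have "frechet_derivative g (at y) t = t * g' y" for t
      using linear_scale[OF has_derivative_linear[OF D], of t 1] by (simp add: g'_def)
    then have "frechet_derivative g (at y) = (\<lambda>t. t * g' y)" by blast
    with D show ?thesis by simp
  qed
  show ?case
  proof (rule Ck_on_SucI[OF \<open>open X\<close>])
    show "((\<lambda>x. g (f x)) has_derivative (\<lambda>v. frechet_derivative f (at x) v * g' (f x))) (at x)"
      if "x \<in> X" for x
      using has_derivative_compose[OF Ck_on_SucD[OF Suc.prems(2) that] g'] .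
    have "Ck_on k g' UNIV"
      using Suc.prems(1) by (simp add: g'_def[abs_def])
    then have "Ck_on k (\<lambda>x. g' (f x)) X"
      using Suc.IH Ck_on_Suc_imp_Ck_on[OF Suc.prems(2)] by blast
    then show "Ck_on k (\<lambda>x. frechet_derivative f (at x) v * g' (f x)) X" for v
      using Suc.prems(2) by (auto intro: Ck_on_mult[OF \<open>open X\<close>])
  qed
qed

lemma Ck_on_compose_linear:
  assumes "open X" "bounded_linear A" "A ` X \<subseteq> Y" "Ck_on k f Y"
  shows "Ck_on k (\<lambda>x. f (A x)) X"
  using assms(4)
proof (induction k arbitrary: f)
  case 0
  then show ?case
    using assms(2,3) by (auto intro: continuous_on_compose2[OF _ linear_continuous_on])
next
  case (Suc k)
  have "((\<lambda>x. f (A x)) has_derivative (\<lambda>v. frechet_derivative f (at (A x)) (A v))) (at x)"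
    if "x \<in> X" for x
    using has_derivative_compose[OF bounded_linear_imp_has_derivative[OF assms(2)]]
      Ck_on_SucD[OF Suc.prems] assms(3) that by blast
  then show ?case
    by (rule Ck_on_SucI[OF \<open>open X\<close>]) (use Suc in auto)
qed

lemma smooth_on_const: "open X \<Longrightarrow> smooth_on X (\<lambda>_. c)"
  by (simp add: smooth_on_def Ck_on_const)

lemma smooth_on_add:
  "open X \<Longrightarrow> smooth_on X f \<Longrightarrow> smooth_on X g \<Longrightarrow> smooth_on X (\<lambda>x. f x + g x)"
  by (simp add: smooth_on_def Ck_on_add)

lemma smooth_on_mult:
  fixes f g :: "'a::euclidean_space \<Rightarrow> real"
  shows "open X \<Longrightarrow> smooth_on X f \<Longrightarrow> smooth_on X g \<Longrightarrow> smooth_on X (\<lambda>x. f x * g x)"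
  by (simp add: smooth_on_def Ck_on_mult)

lemma smooth_on_diff:
  fixes f g :: "'a::euclidean_space \<Rightarrow> real"
  assumes "open X" "smooth_on X f" "smooth_on X g"
  shows "smooth_on X (\<lambda>x. f x - g x)"
  using smooth_on_add[OF assms(1,2) smooth_on_mult[OF assms(1) smooth_on_const[OF assms(1), of "-1"]
        assms(3)]]
  by simp

lemma smooth_on_sum:
  assumes "open X" "\<And>i. i \<in> I \<Longrightarrow> smooth_on X (f i)"
  shows "smooth_on X (\<lambda>x. \<Sum>i\<in>I. f i x)"
  using assms(2)
  by (induction I rule: infinite_finite_induct)
    (auto intro: smooth_on_add smooth_on_const assms(1))

lemma smooth_on_compose_real:
  fixes f :: "'a::euclidean_space \<Rightarrow> real" and g :: "real \<Rightarrow> real"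
  shows "open X \<Longrightarrow> smooth_on UNIV g \<Longrightarrow> smooth_on X f \<Longrightarrow> smooth_on X (\<lambda>x. g (f x))"
  by (simp add: smooth_on_def Ck_on_compose_real)

lemma smooth_on_compose_linear:
  "open X \<Longrightarrow> bounded_linear A \<Longrightarrow> A ` X \<subseteq> Y \<Longrightarrow> smooth_on Y f \<Longrightarrow> smooth_on X (\<lambda>x. f (A x))"
  by (auto simp: smooth_on_def intro: Ck_on_compose_linear)


section \<open>Smoothness of the network Hamiltonian\<close>

text \<open>A layer reads only the inputs below \<open>d\<close>, but produces a smooth output at every index. Hence
  the output index is unrestricted once there is at least one layer; an empty network would return
  its input at an index that need not be below \<open>d\<close>.\<close>

lemma smooth_on_net_eval:
  assumes "open X" "G \<noteq> []"
    and "\<And>l. l \<in> set G \<Longrightarrow> smooth_on UNIV (act l)"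
    and "\<And>j. j < d \<Longrightarrow> smooth_on X (f j)"
  shows "smooth_on X (\<lambda>x. net_eval G d (\<lambda>j. f j x) i)"
  using assms(2-)
proof (induction G arbitrary: d f)
  case (Cons l G)
  have layer: "smooth_on X (\<lambda>x. act l ((\<Sum>j<d. weight l k j * f j x) + bias l k))" for k
    by (rule smooth_on_compose_real[OF \<open>open X\<close> Cons.prems(2)])
      (use Cons.prems(3) \<open>open X\<close> in
        \<open>auto intro!: smooth_on_add smooth_on_sum smooth_on_mult intro: smooth_on_const\<close>)
  show ?case
  proof (cases "G = []")
    case True
    with layer show ?thesis by simp
  next
    case False
    with Cons.IH[OF False _ layer] Cons.prems(2) show ?thesis by simp
  qed
qed simp


section \<open>Invariant tori from a small error\<close>

lemma sup_norm_minus_commute: "sup_norm U (\<lambda>p. f p - g p) = sup_norm U (\<lambda>p. g p - f p)"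
  by (simp add: sup_norm_def abs_minus_commute)

text \<open>The perturbation \<open>G - H\<close> is taken constant in the parameter \<open>e\<close>, and the model is the perturbed
  Hamiltonian at \<open>e = 1\<close>.\<close>

lemma invariant_tori_of_small_error:
  fixes U :: "(real^'m::finite) set" and H G :: "'m phase \<Rightarrow> real"
  assumes "CARD('m) \<ge> 2" "open U" "J_only U H" "nondegenerate U H"
    and "smooth_on (UNIV \<times> U) H" "smooth_on (UNIV \<times> U) G"
    and "periodic_on U H" "periodic_on U G"
    and threshold: "kam_threshold U H (\<lambda>x _. G x - H x) \<epsilon>0"
    and small: "sup_norm U (\<lambda>x. H x - G x) < ereal \<epsilon>0"
  shows "\<exists>\<T>. invariant_tori U G \<T>"
proof -
  have open_phase: "open (UNIV \<times> U :: 'm phase set)"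
    using \<open>open U\<close> by (simp add: open_Times)
  have "smooth_on ((UNIV \<times> U) \<times> UNIV) (\<lambda>z::'m phase \<times> real. G (fst z) - H (fst z))"
    using assms(5,6)
    by (intro smooth_on_compose_linear[OF _ bounded_linear_fst _ smooth_on_diff[OF open_phase]])
      (auto intro!: open_Times open_phase)
  then have smooth: "smooth_on ((UNIV \<times> U) \<times> UNIV) (\<lambda>(x::'m phase, e::real). G x - H x)"
    by (simp add: case_prod_unfold)
  have "periodic_on U (\<lambda>x. G x - H x)"
    using assms(7,8) unfolding periodic_on_def by metis
  with threshold smooth assms(1-5)
  obtain \<T> where tori: "\<And>e. sup_norm U (\<lambda>x. e * (G x - H x)) < ereal \<epsilon>0 \<Longrightarrow>
      invariant_tori U (\<lambda>x. H x + e * (G x - H x)) (\<T> e)"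
    unfolding kam_threshold_def by blast
  show ?thesis
    using tori[of 1] small sup_norm_minus_commute[of U H G] by auto
qed

lemma action_angle_periodic:
  assumes "action_angle X S h K N U \<phi> H"
  shows "periodic_on U H"
  using assms unfolding action_angle_def periodic_on_def by metis


section \<open>Inverting the confidence level\<close>

text \<open>Taking logarithms in \<open>exp (- n (a/c)\<^sup>2) \<le> d\<close> gives \<open>ln (1/d) / n \<le> (a/c)\<^sup>2\<close>, and for \<open>c > 0\<close> and
  \<open>a \<ge> 0\<close> the square root of the right-hand side is \<open>a / c\<close>. For \<open>c \<le> 0\<close> the slack term is at most \<open>0\<close>.\<close>

lemma confidence_slack_le:
  fixes a c d :: real and n :: nat
  assumes "0 < n" "0 < d" "d < 1" "0 \<le> a" and level: "exp (- real n * (a / c)\<^sup>2) \<le> d"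
  shows "c * sqrt (ln (1 / d) / real n) \<le> a"
proof (cases "c > 0")
  case True
  have "- real n * (a / c)\<^sup>2 \<le> ln d"
    using level \<open>0 < d\<close> by (simp add: ln_ge_iff)
  then have "ln (1 / d) \<le> (a / c)\<^sup>2 * real n"
    using \<open>0 < d\<close> by (simp add: ln_div mult.commute)
  then have "ln (1 / d) / real n \<le> (a / c)\<^sup>2"
    using \<open>0 < n\<close> by (subst pos_divide_le_eq) simp_all
  then have "sqrt (ln (1 / d) / real n) \<le> sqrt ((a / c)\<^sup>2)"
    by (rule real_sqrt_le_mono)
  also have "\<dots> = a / c"
    using True \<open>0 \<le> a\<close> by simp
  finally show ?thesis
    using True by (simp add: pos_le_divide_eq mult.commute)
next
  case False
  have "0 \<le> sqrt (ln (1 / d) / real n)"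
    using assms(2,3) by simp
  with False have "c * sqrt (ln (1 / d) / real n) \<le> 0"
    by (simp add: mult_nonpos_nonneg)
  with \<open>0 \<le> a\<close> show ?thesis by linarith
qed


section \<open>Invariant tori of the trained model\<close>

theorem theorem10:
  fixes X N K :: "(real^'n) set" and S :: "real^'n^'n" and h :: "real^'n \<Rightarrow> real"
    and F :: "'m::finite \<Rightarrow> real^'n \<Rightarrow> real" and a :: "'m \<Rightarrow> real"
    and U :: "(real^'m) set" and \<phi> :: "'m phase \<Rightarrow> real^'n" and H :: "'m phase \<Rightarrow> real"
    and d :: nat and enc :: "nat \<Rightarrow> 'm phase \<Rightarrow> real" and \<H> :: "network set"
    and P :: "'w measure" and n :: nat and u :: "nat \<Rightarrow> 'w \<Rightarrow> 'm phase" and net :: "'w \<Rightarrow> network"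
    and p c1 c2 c3 R \<epsilon>0 :: real and L \<delta> :: "'w \<Rightarrow> real"
  assumes dim: "CARD('m) \<ge> 2"
    and integrable: "liouville_integrable X S h F"
    and level_set: "K = {x\<in>X. \<forall>i. F i x = a i}" "K \<noteq> {}" "connected K" "compact K"
    and coordinates: "action_angle X S h K N U \<phi> H"
    and smooth_H: "smooth_on (UNIV \<times> U) H"
    and nondegenerate_H: "nondegenerate U H"
    and smooth_enc: "\<And>j. j < d \<Longrightarrow> smooth_on (UNIV \<times> U) (enc j)"
    and input_layer: "\<And>G. G \<in> \<H> \<Longrightarrow> G \<noteq> []"
    and smooth_act: "\<And>G l. G \<in> \<H> \<Longrightarrow> l \<in> set G \<Longrightarrow> smooth_on UNIV (act l)"
    and periodic_net: "\<And>G. G \<in> \<H> \<Longrightarrow> periodic_on U (H_net d enc G)"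
    and prob: "prob_space P"
    and data: "0 < n" "\<And>j. j < n \<Longrightarrow> u j \<in> borel_measurable P"
      "\<And>j w. j < n \<Longrightarrow> w \<in> space P \<Longrightarrow> u j w \<in> UNIV \<times> U"
    and trained: "\<And>w. w \<in> space P \<Longrightarrow> net w \<in> \<H>"
    and exponent: "p > 2 * real CARD('m)"
    and L_train: "\<And>w. L w = train_loss p H (H_net d enc (net w)) n (\<lambda>j. u j w)"
    and R_n: "AE w in P. rademacher n ((\<lambda>G j. loss p H (H_net d enc G) (u j w)) ` \<H>) \<le> ereal R"
    and generalization: "\<And>\<eta>. 0 < \<eta> \<Longrightarrow> \<eta> < 1 \<Longrightarrow>
      with_prob_ge P (1 - \<eta>) (\<lambda>w. sup_norm U (\<lambda>x. H x - H_net d enc (net w) x)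
        < ereal (c1 * L w + c2 * R + c3 * sqrt (ln (1 / \<eta>) / real n)))"
    and threshold: "\<And>w. w \<in> space P \<Longrightarrow>
      kam_threshold U H (\<lambda>x _. H_net d enc (net w) x - H x) \<epsilon>0"
    and delta: "\<And>w. \<delta> w = exp (- real n * ((\<epsilon>0 - c1 * L w - c2 * R) / c3)\<^sup>2)"
  shows "holds_with_confidence P \<delta>
    (\<lambda>w. c1 * L w + c2 * R \<le> \<epsilon>0 \<longrightarrow> (\<exists>\<T>. invariant_tori U (H_net d enc (net w)) \<T>))"
proof -
  from coordinates have "open U" "J_only U H"
    by (auto simp: action_angle_def)
  have smooth_net: "smooth_on (UNIV \<times> U) (H_net d enc G)" if "G \<in> \<H>" for G
    unfolding H_net_def[abs_def]
    by (rule smooth_on_net_eval[OF open_Times[OF open_UNIV \<open>open U\<close>] input_layer smooth_act smooth_enc])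
      (use that in auto)
  show ?thesis
    unfolding holds_with_confidence_def
  proof (intro allI impI)
    fix \<eta> :: real
    assume \<eta>: "0 < \<eta> \<and> \<eta> < 1"
    then obtain A where A: "A \<in> sets P" "measure P A \<ge> 1 - \<eta>"
      and error: "\<And>w. w \<in> A \<Longrightarrow> sup_norm U (\<lambda>x. H x - H_net d enc (net w) x)
        < ereal (c1 * L w + c2 * R + c3 * sqrt (ln (1 / \<eta>) / real n))"
      using generalization[of \<eta>] unfolding with_prob_ge_def by blast
    have "\<exists>\<T>. invariant_tori U (H_net d enc (net w)) \<T>"
      if "w \<in> A" "\<delta> w \<le> \<eta>" "c1 * L w + c2 * R \<le> \<epsilon>0" for w
    proof -
      have w: "w \<in> space P"
        using A(1) that(1) sets.sets_into_space by blast
      have "c3 * sqrt (ln (1 / \<eta>) / real n) \<le> \<epsilon>0 - c1 * L w - c2 * R"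
        by (rule confidence_slack_le) (use data(1) \<eta> that delta[of w] in auto)
      then have "sup_norm U (\<lambda>x. H x - H_net d enc (net w) x) < ereal \<epsilon>0"
        by (intro less_le_trans[OF error[OF that(1)]]) simp
      with trained[OF w] threshold[OF w] show ?thesis
        by (intro invariant_tori_of_small_error[OF dim \<open>open U\<close> \<open>J_only U H\<close> nondegenerate_H smooth_H])
          (auto intro: smooth_net periodic_net action_angle_periodic[OF coordinates])
    qed
    with A show "with_prob_ge P (1 - \<eta>) (\<lambda>w. \<delta> w \<le> \<eta> \<longrightarrow> c1 * L w + c2 * R \<le> \<epsilon>0 \<longrightarrow>
        (\<exists>\<T>. invariant_tori U (H_net d enc (net w)) \<T>))"
      unfolding with_prob_ge_def by blast
  qed
qed

end
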